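(* Let $(X,r)$ be a solution, let $\kappa:X\to X$ be a reflection for $(X,r)$, and let $\varphi,\psi:X\to X$ be maps each of which is $\lambda$-centralizing, $\rho$-centralizing, $\lambda$-invariant and $\rho$-invariant. Then the map $\omega:=\varphi\kappa\psi$ is a reflection for $(X,r)$.
   Context: A (set-theoretic) solution (of the Yang-Baxter equation) is a pair $(X,r)$ with $X$ a set and $r:X\times X\to X\times X$ a map satisfying $(r\times \mathrm{id}_X)(\mathrm{id}_X\times r)(r\times \mathrm{id}_X)=(\mathrm{id}_X\times r)(r\times \mathrm{id}_X)(\mathrm{id}_X\times r)$. Write $r(x,y)=(\lambda_x(y),\rho_y(x))$. A reflection for $(X,r)$ is a map $\kappa:X\to X$ with $r(\mathrm{id}_X\times\kappa)r(\mathrm{id}_X\times\kappa)=(\mathrm{id}_X\times\kappa)r(\mathrm{id}_X\times\kappa)r$. A map $f:X\to X$ is $\lambda$-centralizing if $\lambda_xf=f\lambda_x$ for all $x$; $\rho$-centralizing if $\rho_xf=f\rho_x$ for all $x$; $\lambda$-invariant if $\lambda_{f(x)}=\lambda_x$ for all $x$; $\rho$-invariant if $\rho_{f(x)}=\rho_x$ for all $x$. Juxtaposition of maps denotes composition. *)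

theory Defs
  imports Main "HOL-Library.FuncSet"
begin

text \<open>
  The underlying set of a solution is a carrier \<open>X :: 'a set\<close>, possibly empty.  Maps are
  total HOL functions that send the carrier into itself; their values outside the carrier are
  irrelevant, so equality of maps means pointwise equality on the carrier.
\<close>

text \<open>
  \<open>X \<times> X \<times> X\<close> is right-nested in HOL, so \<open>id \<times> r\<close> is \<open>map_prod id r\<close>,
  while \<open>r \<times> id\<close> requires reassociating the triple.
\<close>

definition r_times_id :: "('a \<times> 'a \<Rightarrow> 'a \<times> 'a) \<Rightarrow> 'a \<times> 'a \<times> 'a \<Rightarrow> 'a \<times> 'a \<times> 'a" where
  "r_times_id r = (\<lambda>(x, y, z). (fst (r (x, y)), snd (r (x, y)), z))"

definition ybe_solution :: "'a set \<Rightarrow> ('a \<times> 'a \<Rightarrow> 'a \<times> 'a) \<Rightarrow> bool" where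
  "ybe_solution X r \<longleftrightarrow>
     r \<in> (X \<times> X) \<rightarrow> (X \<times> X) \<and>
     (\<forall>t \<in> X \<times> X \<times> X.
        (r_times_id r \<circ> map_prod id r \<circ> r_times_id r) t =
        (map_prod id r \<circ> r_times_id r \<circ> map_prod id r) t)"

text \<open>\<open>r (x, y) = (\<lambda>\<^sub>x(y), \<rho>\<^sub>y(x))\<close>: the first argument after \<open>r\<close> is the index.\<close>

definition lam :: "('a \<times> 'a \<Rightarrow> 'a \<times> 'a) \<Rightarrow> 'a \<Rightarrow> 'a \<Rightarrow> 'a" where
  "lam r x y = fst (r (x, y))"

definition rho :: "('a \<times> 'a \<Rightarrow> 'a \<times> 'a) \<Rightarrow> 'a \<Rightarrow> 'a \<Rightarrow> 'a" where
  "rho r y x = snd (r (x, y))"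

definition reflection :: "'a set \<Rightarrow> ('a \<times> 'a \<Rightarrow> 'a \<times> 'a) \<Rightarrow> ('a \<Rightarrow> 'a) \<Rightarrow> bool" where
  "reflection X r \<kappa> \<longleftrightarrow>
     \<kappa> \<in> X \<rightarrow> X \<and>
     (\<forall>p \<in> X \<times> X.
        (r \<circ> map_prod id \<kappa> \<circ> r \<circ> map_prod id \<kappa>) p =
        (map_prod id \<kappa> \<circ> r \<circ> map_prod id \<kappa> \<circ> r) p)"

definition lam_centralizing :: "'a set \<Rightarrow> ('a \<times> 'a \<Rightarrow> 'a \<times> 'a) \<Rightarrow> ('a \<Rightarrow> 'a) \<Rightarrow> bool" where
  "lam_centralizing X r f \<longleftrightarrow> (\<forall>x\<in>X. \<forall>y\<in>X. (lam r x \<circ> f) y = (f \<circ> lam r x) y)"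

definition rho_centralizing :: "'a set \<Rightarrow> ('a \<times> 'a \<Rightarrow> 'a \<times> 'a) \<Rightarrow> ('a \<Rightarrow> 'a) \<Rightarrow> bool" where
  "rho_centralizing X r f \<longleftrightarrow> (\<forall>x\<in>X. \<forall>y\<in>X. (rho r x \<circ> f) y = (f \<circ> rho r x) y)"

definition lam_invariant :: "'a set \<Rightarrow> ('a \<times> 'a \<Rightarrow> 'a \<times> 'a) \<Rightarrow> ('a \<Rightarrow> 'a) \<Rightarrow> bool" where
  "lam_invariant X r f \<longleftrightarrow> (\<forall>x\<in>X. \<forall>y\<in>X. lam r (f x) y = lam r x y)"

definition rho_invariant :: "'a set \<Rightarrow> ('a \<times> 'a \<Rightarrow> 'a \<times> 'a) \<Rightarrow> ('a \<Rightarrow> 'a) \<Rightarrow> bool" where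
  "rho_invariant X r f \<longleftrightarrow> (\<forall>x\<in>X. \<forall>y\<in>X. rho r (f x) y = rho r x y)"

end

theory Submission
  imports Defs
begin

text \<open>
  A map \<open>f\<close> that centralizes and leaves invariant both families \<open>\<lambda>\<close> and \<open>\<rho>\<close> can be moved through
  \<open>r\<close> at the price of changing the coordinate it acts on:
  \<open>r (id \<times> f) = (f \<times> id) r\<close> and \<open>r (f \<times> id) = (id \<times> f) r\<close>.
  With these two rules, every \<open>\<phi>\<close> in the reflection equation for \<open>\<phi> \<kappa> \<psi>\<close> can be pushed to the left
  end and every \<open>\<psi>\<close> to the right end.  Each side contains \<open>\<phi>\<close> and \<open>\<psi>\<close> twice; on each side the two
  copies pass \<open>r\<close> in such a way that they end up in different coordinates, and a copy crosses \<open>id \<times> \<kappa>\<close>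
  only while it sits in the first coordinate, where the two maps commute.  So the equation becomes
  \<open>(\<phi> \<times> \<phi>) r (id \<times> \<kappa>) r (id \<times> \<kappa>) (\<psi> \<times> \<psi>) =
  (\<phi> \<times> \<phi>) (id \<times> \<kappa>) r (id \<times> \<kappa>) r (\<psi> \<times> \<psi>)\<close>,
  which is the reflection equation for \<open>\<kappa>\<close> between \<open>\<phi> \<times> \<phi>\<close> and \<open>\<psi> \<times> \<psi>\<close>.
\<close>

text \<open>
  Centralization handles the coordinate in which \<open>\<lambda>\<^sub>x\<close> (or \<open>\<rho>\<^sub>y\<close>) is evaluated, and invariance the
  coordinate in which the argument is an index.
\<close>

lemma r_apply_second:
  assumes "lam_centralizing X r f" "rho_invariant X r f" "x \<in> X" "y \<in> X"
  shows "r (x, f y) = map_prod f id (r (x, y))"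
  using assms
  by (auto simp: lam_centralizing_def rho_invariant_def lam_def rho_def prod_eq_iff)

lemma r_apply_first:
  assumes "rho_centralizing X r f" "lam_invariant X r f" "x \<in> X" "y \<in> X"
  shows "r (f x, y) = map_prod id f (r (x, y))"
  using assms
  by (auto simp: rho_centralizing_def lam_invariant_def lam_def rho_def prod_eq_iff)

theorem theorem4p8:
  fixes X :: "'a set"
    and r :: "'a \<times> 'a \<Rightarrow> 'a \<times> 'a"
    and \<kappa> \<phi> \<psi> :: "'a \<Rightarrow> 'a"
  assumes "ybe_solution X r"
    and "reflection X r \<kappa>"
    and "\<phi> \<in> X \<rightarrow> X" and "\<psi> \<in> X \<rightarrow> X"
    and "lam_centralizing X r \<phi>" and "rho_centralizing X r \<phi>"
    and "lam_invariant X r \<phi>" and "rho_invariant X r \<phi>"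
    and "lam_centralizing X r \<psi>" and "rho_centralizing X r \<psi>"
    and "lam_invariant X r \<psi>" and "rho_invariant X r \<psi>"
  shows "reflection X r (\<phi> \<circ> \<kappa> \<circ> \<psi>)"
proof -
  have \<kappa>X: "\<kappa> x \<in> X" and \<phi>X: "\<phi> x \<in> X" and \<psi>X: "\<psi> x \<in> X" if "x \<in> X" for x
    using assms(2-4) that by (auto simp: reflection_def)
  have rX: "a \<in> X \<and> b \<in> X" if "r (x, y) = (a, b)" "x \<in> X" "y \<in> X" for x y a b
    using assms(1) that by (force simp: ybe_solution_def Pi_iff)
  note \<phi>_second = r_apply_second[OF assms(5,8)]
  note \<phi>_first = r_apply_first[OF assms(6,7)]
  note \<psi>_second = r_apply_second[OF assms(9,12)]
  note \<psi>_first = r_apply_first[OF assms(10,11)]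
  let ?K = "map_prod id \<kappa>" and ?W = "map_prod id (\<phi> \<circ> \<kappa> \<circ> \<psi>)"
  have "(r \<circ> ?W \<circ> r \<circ> ?W) (x, y) = (?W \<circ> r \<circ> ?W \<circ> r) (x, y)"
    if x: "x \<in> X" and y: "y \<in> X" for x y
  proof -
    have left: "(r \<circ> ?W \<circ> r \<circ> ?W) (x, y) = map_prod \<phi> \<phi> ((r \<circ> ?K \<circ> r \<circ> ?K) (\<psi> x, \<psi> y))"
    proof -
      obtain a b where ab: "r (x, \<kappa> (\<psi> y)) = (a, b)" by fastforce
      have X: "a \<in> X" "b \<in> X" using rX[OF ab] x y \<kappa>X \<psi>X by auto
      have "r (\<psi> x, \<kappa> (\<psi> y)) = (a, \<psi> b)"
        using \<psi>_first x y \<kappa>X \<psi>X ab by simp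
      moreover have "r (x, \<phi> (\<kappa> (\<psi> y))) = (\<phi> a, b)"
        using \<phi>_second x y \<kappa>X \<psi>X ab by simp
      moreover have "r (\<phi> a, \<phi> (\<kappa> (\<psi> b))) = map_prod \<phi> \<phi> (r (a, \<kappa> (\<psi> b)))"
        using \<phi>_first \<phi>_second X \<kappa>X \<psi>X \<phi>X by (simp add: map_prod.compositionality)
      ultimately show ?thesis by simp
    qed
    have right: "(?W \<circ> r \<circ> ?W \<circ> r) (x, y) = map_prod \<phi> \<phi> ((?K \<circ> r \<circ> ?K \<circ> r) (\<psi> x, \<psi> y))"
    proof -
      obtain c d where cd: "r (x, y) = (c, d)" by fastforce
      have X: "c \<in> X" "d \<in> X" using rX[OF cd] x y by auto
      have "r (\<psi> x, \<psi> y) = (\<psi> c, \<psi> d)"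
        using \<psi>_first \<psi>_second x y \<psi>X cd by simp
      moreover have "r (c, \<phi> (\<kappa> (\<psi> d))) = map_prod \<phi> id (r (c, \<kappa> (\<psi> d)))"
        using \<phi>_second X \<kappa>X \<psi>X by simp
      moreover have "r (\<psi> c, \<kappa> (\<psi> d)) = map_prod id \<psi> (r (c, \<kappa> (\<psi> d)))"
        using \<psi>_first X \<kappa>X \<psi>X by simp
      ultimately show ?thesis using cd by (simp add: map_prod.compositionality o_assoc)
    qed
    have "(r \<circ> ?K \<circ> r \<circ> ?K) (\<psi> x, \<psi> y) = (?K \<circ> r \<circ> ?K \<circ> r) (\<psi> x, \<psi> y)"
      using assms(2) x y \<psi>X by (simp add: reflection_def)
    with left right show ?thesis by simp
  qed
  then show ?thesis
    unfolding reflection_def using \<kappa>X \<phi>X \<psi>X by auto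
qed

end
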